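(* There is a set $X \subseteq \omega^{\uparrow\omega}$ with $X \in t^0$ and $X \notin r^0$, i.e. $t^0 \setminus r^0 \neq \emptyset$.
   Context: $\omega^{\uparrow<\omega}$ denotes the set of strictly increasing finite sequences of natural numbers and $\omega^{\uparrow\omega}$ the set of strictly increasing infinite sequences (identified with infinite subsets of $\omega$ via increasing enumeration). A tree is a nonempty subset $T\subseteq\omega^{\uparrow<\omega}$ closed under initial segments; $[T]$ is its set of infinite branches in $\omega^{\uparrow\omega}$. For a family $\mathbb P$ of trees, the associated ideal consists of all $X\subseteq\omega^{\uparrow\omega}$ such that for every $T\in\mathbb P$ there is $T'\in\mathbb P$ with $T'\subseteq T$ and $[T']\cap X=\emptyset$. A Matet tree is determined by a finite set $s\subseteq\omega$ and a sequence $\{a_n;n\in\omega\}$ of nonempty finite subsets of $\omega$ with $\max s<\min a_0$ and $\max a_n<\min a_{n+1}$; it is the tree of all finite initial segments of increasing enumerations of sets $s\cup\bigcup_{n\in B}a_n$ with $B\subseteq\omega$ infinite; $t^0$ is the ideal associated with Matet trees. A Mathias tree is determined by a finite set $s\subseteq\omega$ and an infinite set $A\subseteq\omega$ with $\max s<\min A$; it is the tree of all finite initial segments of increasing enumerations of sets $s\cup y$ with $y\subseteq A$ infinite; $r^0$ is the ideal associated with Mathias trees. *)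

theory Defs
  imports Main "HOL-Library.Infinite_Set" "HOL-Library.Sublist"
begin

definition incr_fin_seqs :: "nat list set" where
  "incr_fin_seqs = {u. sorted_wrt (<) u}"

definition incr_inf_seqs :: "(nat \<Rightarrow> nat) set" where
  "incr_inf_seqs = {x. strict_mono x}"

definition is_tree :: "nat list set \<Rightarrow> bool" where
  "is_tree T \<longleftrightarrow> T \<noteq> {} \<and> T \<subseteq> incr_fin_seqs \<and> (\<forall>u\<in>T. \<forall>v. prefix v u \<longrightarrow> v \<in> T)"

definition init_seg :: "(nat \<Rightarrow> nat) \<Rightarrow> nat \<Rightarrow> nat list" where
  "init_seg x k = map x [0..<k]"

definition branches :: "nat list set \<Rightarrow> (nat \<Rightarrow> nat) set" where
  "branches T = {x \<in> incr_inf_seqs. \<forall>k. init_seg x k \<in> T}"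

definition assoc_ideal :: "nat list set set \<Rightarrow> (nat \<Rightarrow> nat) set set" where
  "assoc_ideal P = {X. X \<subseteq> incr_inf_seqs \<and>
     (\<forall>T\<in>P. \<exists>T'\<in>P. T' \<subseteq> T \<and> branches T' \<inter> X = {})}"

text \<open>The condition max s < min t, read as vacuously true when s is empty.\<close>

definition set_before :: "nat set \<Rightarrow> nat set \<Rightarrow> bool" where
  "set_before s t \<longleftrightarrow> (\<forall>i\<in>s. \<forall>j\<in>t. i < j)"

text \<open>
  The increasing enumeration of an infinite set \<open>S\<close> of natural numbers is
  \<open>enumerate S\<close>; it is applied to infinite sets only.
\<close>

definition matet_tree :: "nat set \<Rightarrow> (nat \<Rightarrow> nat set) \<Rightarrow> nat list set" where
  "matet_tree s a = {init_seg (enumerate (s \<union> (\<Union>n\<in>B. a n))) k | B k. infinite B}"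

definition matet_trees :: "nat list set set" where
  "matet_trees = {matet_tree s a | s a.
     finite s \<and> (\<forall>n. finite (a n) \<and> a n \<noteq> {}) \<and>
     set_before s (a 0) \<and> (\<forall>n. set_before (a n) (a (Suc n)))}"

definition mathias_tree :: "nat set \<Rightarrow> nat set \<Rightarrow> nat list set" where
  "mathias_tree s A = {init_seg (enumerate (s \<union> y)) k | y k. y \<subseteq> A \<and> infinite y}"

definition mathias_trees :: "nat list set set" where
  "mathias_trees = {mathias_tree s A | s A. finite s \<and> infinite A \<and> set_before s A}"

definition t0_ideal :: "(nat \<Rightarrow> nat) set set" where
  "t0_ideal = assoc_ideal matet_trees"

definition r0_ideal :: "(nat \<Rightarrow> nat) set set" where
  "r0_ideal = assoc_ideal mathias_trees"

lemma init_seg_enumerate_incr: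
  assumes "infinite S"
  shows "init_seg (enumerate S) k \<in> incr_fin_seqs"
  using assms
  by (auto simp: incr_fin_seqs_def init_seg_def sorted_wrt_iff_nth_less intro: enumerate_mono)

lemma prefix_init_seg:
  assumes "prefix v (init_seg x k)"
  shows "\<exists>j. v = init_seg x j"
proof -
  have "v = take (length v) (init_seg x k)" "length v \<le> k"
    using assms by (auto simp: prefix_def init_seg_def dest: arg_cong[of _ _ length])
  then have "v = init_seg x (length v)"
    by (metis init_seg_def take_map take_upt add_0)
  then show ?thesis by blast
qed

lemma infinite_block_union:
  assumes ne: "\<And>n. a n \<noteq> {}" and ord: "\<And>n. set_before (a n) (a (Suc n))" and B: "infinite B"
  shows "infinite (\<Union>n\<in>B. a n)"
proof -
  define m where "m n = (LEAST i. i \<in> a n)" for n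
  have m: "m n \<in> a n" for n
    unfolding m_def using ne[of n] by (metis LeastI_ex ex_in_conv)
  have "strict_mono m"
    unfolding strict_mono_Suc_iff using m ord by (auto simp: set_before_def)
  then have "inj_on m B" by (auto intro: inj_on_subset strict_mono_imp_inj_on)
  then have "infinite (m ` B)" using B finite_imageD by blast
  moreover have "m ` B \<subseteq> (\<Union>n\<in>B. a n)" using m by blast
  ultimately show ?thesis using finite_subset by blast
qed

lemma is_tree_matet:
  assumes "T \<in> matet_trees"
  shows "is_tree T"
proof -
  obtain s a where T: "T = matet_tree s a"
    and ne: "\<And>n. a n \<noteq> {}" and ord: "\<And>n. set_before (a n) (a (Suc n))"
    using assms unfolding matet_trees_def by blast
  have "infinite (s \<union> (\<Union>n\<in>B. a n))" if "infinite B" for B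
    using infinite_block_union[of a, OF ne ord that] by blast
  then have "T \<subseteq> incr_fin_seqs"
    unfolding T matet_tree_def using init_seg_enumerate_incr by blast
  moreover have "T \<noteq> {}" unfolding T matet_tree_def using infinite_UNIV_nat by blast
  moreover have "\<forall>u\<in>T. \<forall>v. prefix v u \<longrightarrow> v \<in> T"
    unfolding T matet_tree_def using prefix_init_seg by blast
  ultimately show ?thesis unfolding is_tree_def by blast
qed

lemma is_tree_mathias:
  assumes "T \<in> mathias_trees"
  shows "is_tree T"
proof -
  obtain s A where T: "T = mathias_tree s A" and A: "infinite A"
    using assms unfolding mathias_trees_def by blast
  have "T \<subseteq> incr_fin_seqs"
    unfolding T mathias_tree_def using init_seg_enumerate_incr by (auto simp: infinite_Un)
  moreover have "T \<noteq> {}" unfolding T mathias_tree_def using A by blast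
  moreover have "\<forall>u\<in>T. \<forall>v. prefix v u \<longrightarrow> v \<in> T"
    unfolding T mathias_tree_def using prefix_init_seg by blast
  ultimately show ?thesis unfolding is_tree_def by blast
qed

end

theory Submission
  imports Defs "HOL-Library.Nat_Bijection" "HOL-Library.Countable"
begin

text \<open>
  Call a Matet tree thick if each of its blocks has at least three elements; every Matet tree
  has a thick Matet subtree. Trees are sets of finite sequences, so they are indexed by a
  well-order of type continuum in which proper initial segments are smaller than the continuum.

  Below every Mathias tree there is a family of continuum many branches \<open>s \<union> y\<close> such that any two
  of the sets \<open>y\<close> are eventually different and interleaved. A block with three elements of one
  such branch surrounds an element of the other, so a thick Matet tree contains at most one member
  of the family. Hence every Mathias tree has a branch that lies on none of the thick Matet trees
  preceding it, and \<open>X\<close> consists of one such branch for each Mathias tree. It meets all Mathias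
  trees, and it meets a thick Matet tree in fewer than continuum many points. Thinning out the
  blocks along an almost disjoint family gives continuum many Matet subtrees without common
  branches, so one of them misses \<open>X\<close>.
\<close>

section \<open>Well-orders with small initial segments\<close>

text \<open>\<open>I\<close> sends a point to its closed initial segment in a well-order of least
  possible length. \<open>g\<close> makes \<open>'b\<close> at least as large as \<open>'a\<close>,
  so an injection of \<open>'b\<close> into a segment would yield one of \<open>'a\<close>.\<close>

lemma ex_small_initial_segments:
  fixes g :: "'a \<Rightarrow> 'b"
  assumes "inj g" "infinite (UNIV :: 'a set)"
  shows "\<exists>I :: 'a \<Rightarrow> 'a set. (\<forall>a b. a \<in> I b \<or> b \<in> I a) \<and>
           (\<forall>a (f :: 'b \<Rightarrow> 'a). inj f \<longrightarrow> \<not> range f \<subseteq> I a)"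
proof -
  define r where "r = card_of (UNIV :: 'a set)"
  have co: "Card_order r" and fld: "Field r = UNIV"
    unfolding r_def by (rule card_of_Card_order, rule Field_card_of)
  have lin: "refl_on UNIV r" "total_on UNIV r" "trans r" "antisym r"
    using co fld by (simp_all add: card_order_on_def order_on_defs)
  have "a \<in> under r b \<or> b \<in> under r a" for a b
    using lin(1,2) by (cases "a = b") (auto simp: under_def total_on_def refl_on_def)
  moreover have "\<not> range f \<subseteq> under r a" if f: "inj f" for a and f :: "'b \<Rightarrow> 'a"
  proof
    assume sub: "range f \<subseteq> under r a"
    \<comment> \<open>An infinite cardinal order has no last element, so a closed segment fits into
      an open one, and open segments are smaller than the whole order.\<close>
    obtain b where b: "a \<noteq> b" "(a, b) \<in> r"
      using infinite_Card_order_limit[OF co] assms(2) fld by auto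
    have "under r a \<subseteq> underS r b"
      using b lin(3,4) unfolding under_def underS_def by (blast dest: transD antisymD)
    then have "range (f \<circ> g) \<subseteq> underS r b" using sub by auto
    moreover have "inj (f \<circ> g)" using f assms(1) by (rule inj_compose)
    ultimately have "(card_of (UNIV :: 'a set), card_of (underS r b)) \<in> ordLeq"
      using card_of_ordLeq by blast
    moreover have "(card_of (underS r b), r) \<in> ordLess"
      using card_of_underS[OF co] fld by auto
    ultimately show False
      unfolding r_def using not_ordLess_ordLeq by blast
  qed
  ultimately show ?thesis by blast
qed

section \<open>An interleaved almost disjoint family of sequences\<close>

text \<open>Codes the node at level \<open>n\<close> of the binary tree on the path \<xi>. The
  leading bit \<open>n\<close> records the level, so each level gets its own dyadic
  interval.\<close>

definition initial_code :: "nat set \<Rightarrow> nat \<Rightarrow> nat" where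
  "initial_code \<xi> n = set_encode (insert n (\<xi> \<inter> {..<n}))"

lemma initial_code_bounds: "2 ^ n \<le> initial_code \<xi> n" "initial_code \<xi> n < 2 ^ Suc n"
proof -
  have eq: "initial_code \<xi> n = 2 ^ n + (\<Sum>i\<in>\<xi> \<inter> {..<n}. 2 ^ i)"
    by (simp add: initial_code_def set_encode_def)
  then show "2 ^ n \<le> initial_code \<xi> n" by simp
  have "(\<Sum>i\<in>\<xi> \<inter> {..<n}. 2 ^ i) \<le> (\<Sum>i<n. 2 ^ i :: nat)"
    by (rule sum_mono2) auto
  also have "\<dots> < 2 ^ n"
    by (induction n) auto
  finally show "initial_code \<xi> n < 2 ^ Suc n" using eq by simp
qed

text \<open>Levels occupy increasing intervals, whichever paths are followed. Distinct \<xi> and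
  \<eta> give the interleaving; equal ones give monotonicity.\<close>

lemma initial_code_less:
  assumes "m < n"
  shows "initial_code \<xi> m < initial_code \<eta> n"
proof -
  have "initial_code \<xi> m < 2 ^ Suc m" by (rule initial_code_bounds)
  also have "\<dots> \<le> 2 ^ n" using assms by (intro power_increasing) auto
  also have "\<dots> \<le> initial_code \<eta> n" by (rule initial_code_bounds)
  finally show ?thesis .
qed

lemma strict_mono_initial_code: "strict_mono (initial_code \<xi>)"
  by (simp add: strict_mono_def initial_code_less)

lemma initial_code_eqD:
  assumes "initial_code \<xi> m = initial_code \<eta> n"
  shows "m = n" "\<xi> \<inter> {..<n} = \<eta> \<inter> {..<n}"
proof -
  show mn: "m = n"
    using assms initial_code_less[of m n \<xi> \<eta>] initial_code_less[of n m \<eta> \<xi>]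
    by (metis less_irrefl nat_neq_iff)
  have "insert n (\<xi> \<inter> {..<n}) = insert n (\<eta> \<inter> {..<n})"
    using assms unfolding mn initial_code_def by (subst (asm) set_encode_eq) auto
  then show "\<xi> \<inter> {..<n} = \<eta> \<inter> {..<n}" by (auto simp: set_eq_iff)
qed

text \<open>Equal codes have equal levels and equal paths below that level, which is impossible
  above a point where the paths differ.\<close>

lemma initial_code_eventually_neq:
  assumes "\<xi> \<noteq> \<eta>"
  shows "\<exists>N. \<forall>m. \<forall>n>N. initial_code \<xi> m \<noteq> initial_code \<eta> n"
proof -
  obtain k where "k \<in> \<xi> \<longleftrightarrow> k \<notin> \<eta>" using assms by auto
  then have "initial_code \<xi> m \<noteq> initial_code \<eta> n" if "k < n" for m n
    using that initial_code_eqD(2)[of \<xi> m \<eta> n] by (auto simp: set_eq_iff)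
  then show ?thesis by blast
qed

section \<open>Matet trees and their branches\<close>

locale block_sequence =
  fixes s :: "nat set" and a :: "nat \<Rightarrow> nat set"
  assumes finite_stem: "finite s"
    and finite_block: "finite (a n)"
    and block_nonempty: "a n \<noteq> {}"
    and stem_before_first: "set_before s (a 0)"
    and block_before_Suc: "set_before (a n) (a (Suc n))"
begin

lemma block_less:
  assumes "i < j" "p \<in> a i" "q \<in> a j"
  shows "p < q"
  using assms(1,3)
proof (induction j arbitrary: q)
  case (Suc j)
  have step: "v < q" if "v \<in> a j" for v
    using that Suc.prems block_before_Suc by (auto simp: set_before_def)
  show ?case
  proof (cases "i = j")
    case True
    then show ?thesis using step assms(2) by blast
  next
    case False
    obtain w where w: "w \<in> a j" using block_nonempty by blast
    then have "p < w" using Suc False by simp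
    then show ?thesis using step[OF w] by simp
  qed
qed simp

lemma stem_less:
  assumes "p \<in> s" "q \<in> a j"
  shows "p < q"
proof -
  have first: "p < v" if "v \<in> a 0" for v
    using that assms(1) stem_before_first by (auto simp: set_before_def)
  show ?thesis
  proof (cases "j = 0")
    case True
    then show ?thesis using first assms(2) by blast
  next
    case False
    obtain w where w: "w \<in> a 0" using block_nonempty by blast
    then have "w < q" using block_less[of 0 j] False assms(2) by simp
    then show ?thesis using first[OF w] by simp
  qed
qed

lemma le_block:
  assumes "q \<in> a j"
  shows "j \<le> q"
  using assms
proof (induction j arbitrary: q)
  case (Suc j)
  obtain w where w: "w \<in> a j" using block_nonempty by blast
  then have "j \<le> w" by (rule Suc.IH)
  also have "w < q" using block_less[of j "Suc j"] w Suc.prems by simp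
  finally show ?case by simp
qed simp

lemma block_unique:
  assumes "p \<in> a i" "p \<in> a j"
  shows "i = j"
  using assms block_less by (metis less_irrefl nat_neq_iff)

lemma mem_block_union_iff:
  assumes "p \<in> a n"
  shows "p \<in> s \<union> (\<Union>i\<in>B. a i) \<longleftrightarrow> n \<in> B"
  using assms stem_less block_unique by blast

text \<open>This later turns interleaving into a common point: an element of one branch caught
  between two points of a block must lie in that block.\<close>

lemma block_convex:
  assumes "p \<in> a n" "r \<in> a n" "p < w" "w < r" "w \<in> s \<union> (\<Union>i. a i)"
  shows "w \<in> a n"
proof -
  have "w \<notin> s" using assms stem_less by (meson less_asym)
  then obtain i where "w \<in> a i" using assms(5) by blast
  then show ?thesis
    using assms block_less by (metis less_asym nat_neq_iff)
qed

lemma infinite_union: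
  assumes "infinite B"
  shows "infinite (\<Union>n\<in>B. a n)"
  using infinite_block_union[of a] block_nonempty block_before_Suc assms by blast

lemma matet_tree_in_matet_trees: "matet_tree s a \<in> matet_trees"
  unfolding matet_trees_def
  using finite_stem finite_block block_nonempty stem_before_first block_before_Suc by blast

text \<open>Each initial segment of a branch comes with its own \<open>B\<close>, which may change
  with \<open>k\<close>; the uses take \<open>k\<close> large enough for the points at hand.\<close>

lemma branch_approx:
  assumes "x \<in> branches (matet_tree s a)"
  shows "\<exists>B. infinite B \<and> (\<forall>i<k. x i = enumerate (s \<union> (\<Union>n\<in>B. a n)) i)"
proof -
  have "init_seg x k \<in> matet_tree s a" using assms by (simp add: branches_def)
  then obtain B l where "infinite B"
    and eq: "init_seg x k = init_seg (enumerate (s \<union> (\<Union>n\<in>B. a n))) l"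
    unfolding matet_tree_def by blast
  moreover have "k = l" using arg_cong[OF eq, of length] by (simp add: init_seg_def)
  ultimately show ?thesis by (auto simp: init_seg_def)
qed

lemma range_branch_subset:
  assumes "x \<in> branches (matet_tree s a)"
  shows "range x \<subseteq> s \<union> (\<Union>n. a n)"
proof (intro image_subsetI)
  fix i
  obtain B where B: "infinite B" "\<And>j. j < Suc i \<Longrightarrow> x j = enumerate (s \<union> (\<Union>n\<in>B. a n)) j"
    using branch_approx[OF assms, of "Suc i"] by blast
  have "infinite (s \<union> (\<Union>n\<in>B. a n))" using infinite_union[OF B(1)] by simp
  then have "x i \<in> s \<union> (\<Union>n\<in>B. a n)" unfolding B(2)[OF lessI] by (rule enumerate_in_set)
  then show "x i \<in> s \<union> (\<Union>n. a n)" by blast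
qed

lemma block_subset_range_branch:
  assumes x: "x \<in> branches (matet_tree s a)" and p: "p \<in> a n" "p \<in> range x"
  shows "a n \<subseteq> range x"
proof
  fix q assume q: "q \<in> a n"
  have mono: "strict_mono x" using x by (simp add: branches_def incr_inf_seqs_def)
  obtain j where j: "p = x j" using p by blast
  \<comment> \<open>The segment must contain \<open>p\<close>, at position \<open>j\<close>, and
    reach past the value \<open>q\<close>; the latter holds because \<open>enumerate S k\<close> is
    at least \<open>k\<close>.\<close>
  define k where "k = Suc (max q j)"
  obtain B where B: "infinite B" "\<And>i. i < Suc k \<Longrightarrow> x i = enumerate (s \<union> (\<Union>n\<in>B. a n)) i"
    using branch_approx[OF x, of "Suc k"] by blast
  define S where "S = s \<union> (\<Union>n\<in>B. a n)"
  have S: "infinite S" using infinite_union[OF B(1)] by (simp add: S_def)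
  have xS: "x i = enumerate S i" if "i \<le> k" for i using B(2) that by (simp add: S_def)
  have "x j \<in> S" using xS[of j] enumerate_in_set[OF S] by (simp add: k_def)
  then have "q \<in> S"
    using mem_block_union_iff[OF p(1)] mem_block_union_iff[OF q] j unfolding S_def by simp
  then obtain i where i: "q = enumerate S i" using enumerate_Ex[of S q] S by metis
  have "q < k" by (simp add: k_def)
  also have "k \<le> enumerate S k" using S by (rule le_enumerate)
  finally have "i < k" using i enumerate_mono_iff[OF S] by simp
  then have "q = x i" using i xS[of i] by simp
  then show "q \<in> range x" by (rule range_eqI)
qed

text \<open>\<open>C\<close> is a block sequence of indices with empty stem. Choosing infinitely
  many merged blocks amounts to choosing a certain infinite set of original blocks.\<close>

lemma merge_blocks:
  assumes "block_sequence {} C"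
  defines "b \<equiv> \<lambda>n. \<Union>i\<in>C n. a i"
  shows "block_sequence s b" "matet_tree s b \<subseteq> matet_tree s a"
proof -
  interpret C: block_sequence "{}" C by fact
  show "block_sequence s b"
  proof
    fix n
    show "set_before (b n) (b (Suc n))"
      unfolding b_def set_before_def using C.block_less[of n "Suc n"] block_less by blast
    show "finite (b n)" unfolding b_def using C.finite_block finite_block by blast
    show "b n \<noteq> {}" unfolding b_def using C.block_nonempty block_nonempty by blast
  next
    show "set_before s (b 0)"
      unfolding b_def set_before_def using stem_less by blast
  qed (rule finite_stem)
  show "matet_tree s b \<subseteq> matet_tree s a"
  proof
    fix u assume "u \<in> matet_tree s b"
    then obtain B k where B: "infinite B"
      and u: "u = init_seg (enumerate (s \<union> (\<Union>n\<in>B. b n))) k"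
      unfolding matet_tree_def by blast
    have "(\<Union>n\<in>B. b n) = (\<Union>i\<in>(\<Union>n\<in>B. C n). a i)" by (auto simp: b_def)
    with u have "u = init_seg (enumerate (s \<union> (\<Union>i\<in>(\<Union>n\<in>B. C n). a i))) k" by simp
    with C.infinite_union[OF B] show "u \<in> matet_tree s a"
      unfolding matet_tree_def by blast
  qed
qed

lemma subsequence:
  assumes "strict_mono e"
  shows "block_sequence s (a \<circ> e)" "matet_tree s (a \<circ> e) \<subseteq> matet_tree s a"
proof -
  have "block_sequence {} (\<lambda>n. {e n})"
    using assms by unfold_locales (auto simp: set_before_def strict_mono_Suc_iff)
  from merge_blocks[OF this]
  show "block_sequence s (a \<circ> e)" "matet_tree s (a \<circ> e) \<subseteq> matet_tree s a"
    by (simp_all add: comp_def)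
qed

text \<open>Outside the stem, a common branch only meets blocks whose indices are codes for both
  sets. If the sets differ, these blocks are finitely many, but a branch has infinite range.\<close>

lemma almost_disjoint_subsequences:
  assumes x: "x \<in> branches (matet_tree s (a \<circ> initial_code \<xi>))"
    "x \<in> branches (matet_tree s (a \<circ> initial_code \<eta>))"
  shows "\<xi> = \<eta>"
proof (rule ccontr)
  assume "\<xi> \<noteq> \<eta>"
  then obtain N where N: "\<And>m n. N < n \<Longrightarrow> initial_code \<xi> m \<noteq> initial_code \<eta> n"
    using initial_code_eventually_neq by metis
  have "range x \<subseteq> s \<union> (\<Union>n\<le>N. a (initial_code \<eta> n))"
  proof
    fix p assume "p \<in> range x"
    then have p: "p \<in> s \<union> (\<Union>n. a (initial_code \<zeta> n))"
      if "x \<in> branches (matet_tree s (a \<circ> initial_code \<zeta>))" for \<zeta>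
      using block_sequence.range_branch_subset[OF subsequence(1)[OF strict_mono_initial_code] that]
      by auto
    show "p \<in> s \<union> (\<Union>n\<le>N. a (initial_code \<eta> n))"
    proof (cases "p \<in> s")
      case False
      then obtain m n where mn: "p \<in> a (initial_code \<xi> m)" "p \<in> a (initial_code \<eta> n)"
        using p[OF x(1)] p[OF x(2)] by blast
      then have "n \<le> N" using N[of n m] block_unique by (metis not_le)
      then show ?thesis using mn(2) by blast
    qed simp
  qed
  then have "finite (range x)"
    using finite_stem finite_block by (meson finite_UN_I finite_Un finite_atMost finite_subset)
  moreover have "strict_mono x" using x by (simp add: branches_def incr_inf_seqs_def)
  ultimately show False
    using range_inj_infinite strict_mono_imp_inj_on by blast
qed

end

lemma matet_treesE:
  assumes "T \<in> matet_trees"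
  obtains s a where "block_sequence s a" "T = matet_tree s a"
  using assms unfolding matet_trees_def block_sequence_def by blast

section \<open>Thick Matet trees\<close>

locale thick_block_sequence = block_sequence +
  assumes thick: "\<exists>p\<in>a n. \<exists>q\<in>a n. \<exists>r\<in>a n. p < q \<and> q < r"

definition thick_trees :: "nat list set set" where
  "thick_trees = {matet_tree s a | s a. thick_block_sequence s a}"

lemma (in block_sequence) ex_thick:
  obtains b where "thick_block_sequence s b" "matet_tree s b \<subseteq> matet_tree s a"
proof -
  define C :: "nat \<Rightarrow> nat set" where "C n = {3*n, 3*n+1, 3*n+2}" for n
  have C: "block_sequence {} C"
    by unfold_locales (auto simp: C_def set_before_def)
  define b where "b n = (\<Union>i\<in>C n. a i)" for n
  interpret b: block_sequence s b
    using merge_blocks(1)[OF C] by (simp add: b_def[abs_def])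
  have "thick_block_sequence s b"
  proof
    fix n
    obtain p q r where pqr: "p \<in> a (3*n)" "q \<in> a (3*n+1)" "r \<in> a (3*n+2)"
      using block_nonempty by blast
    then have "p < q" "q < r"
      using block_less[of "3*n" "3*n+1" p q] block_less[of "3*n+1" "3*n+2" q r] by simp_all
    moreover have "p \<in> b n" "q \<in> b n" "r \<in> b n" using pqr by (auto simp: b_def C_def)
    ultimately show "\<exists>p\<in>b n. \<exists>q\<in>b n. \<exists>r\<in>b n. p < q \<and> q < r" by blast
  qed
  then show thesis using that merge_blocks(2)[OF C] by (simp add: b_def[abs_def])
qed

section \<open>Continuum many branches below a Mathias tree\<close>

text \<open>The codes serve as positions in \<open>A\<close>, which carries interleaving and
  eventual difference over to subsets of \<open>A\<close>.\<close>

definition mathias_branch :: "nat set \<Rightarrow> nat set \<Rightarrow> nat set \<Rightarrow> nat \<Rightarrow> nat" where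
  "mathias_branch s A \<xi> = enumerate (s \<union> range (enumerate A \<circ> initial_code \<xi>))"

context
  fixes s A :: "nat set"
  assumes finite_s: "finite s" and infinite_A: "infinite A"
begin

lemma strict_mono_enumerate_code: "strict_mono (enumerate A \<circ> initial_code \<xi>)"
  using infinite_A by (simp add: strict_mono_def initial_code_less)

lemma infinite_range_code: "infinite (range (enumerate A \<circ> initial_code \<xi>))"
  using range_inj_infinite strict_mono_imp_inj_on strict_mono_enumerate_code by blast

lemma range_mathias_branch:
  "range (mathias_branch s A \<xi>) = s \<union> range (enumerate A \<circ> initial_code \<xi>)"
  unfolding mathias_branch_def using infinite_range_code by (intro range_enumerate) simp

lemma mathias_branch_in_branches: "mathias_branch s A \<xi> \<in> branches (mathias_tree s A)"
proof -
  let ?y = "range (enumerate A \<circ> initial_code \<xi>)"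
  have "?y \<subseteq> A" using infinite_A enumerate_in_set by auto
  moreover have "strict_mono (mathias_branch s A \<xi>)"
    unfolding mathias_branch_def using infinite_range_code by (intro strict_mono_enumerate) simp
  ultimately show ?thesis
    using infinite_range_code
    unfolding branches_def incr_inf_seqs_def mathias_tree_def mathias_branch_def by blast
qed

text \<open>Take a late block lying on the first branch, with points from levels
  \<open>i < j < k\<close>. Level \<open>j\<close> of the second branch falls strictly between the
  outer two, hence into the block and onto the first branch, against eventual difference.\<close>

lemma thick_tree_at_most_one_branch:
  assumes T: "T \<in> thick_trees"
    and \<xi>: "mathias_branch s A \<xi> \<in> branches T" and \<eta>: "mathias_branch s A \<eta> \<in> branches T"
  shows "\<xi> = \<eta>"
proof (rule ccontr)
  assume "\<xi> \<noteq> \<eta>"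
  then obtain N where N: "\<And>m n. N < n \<Longrightarrow> initial_code \<xi> m \<noteq> initial_code \<eta> n"
    using initial_code_eventually_neq by metis
  obtain t a where "thick_block_sequence t a" and Ta: "T = matet_tree t a"
    using T by (auto simp: thick_trees_def)
  then interpret thick_block_sequence t a by simp
  define x where "x = (\<lambda>\<xi>. enumerate A \<circ> initial_code \<xi>)"
  have strict_mono_x: "strict_mono (x \<zeta>)" for \<zeta>
    unfolding x_def by (rule strict_mono_enumerate_code)
  have range_x: "range (mathias_branch s A \<zeta>) = s \<union> range (x \<zeta>)" for \<zeta>
    unfolding x_def by (rule range_mathias_branch)
  \<comment> \<open>Points of the first branch above \<open>M\<close> come from levels beyond
    \<open>N\<close>, and blocks with index above \<open>M\<close> lie entirely above
    \<open>M\<close>.\<close>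
  define M where "M = Max (insert (x \<xi> N) s)"
  have M: "x \<xi> N \<le> M" "\<And>p. p \<in> s \<Longrightarrow> p \<le> M" using finite_s by (auto simp: M_def)
  have "infinite (range (mathias_branch s A \<xi>) - (t \<union> (\<Union>i\<le>M. a i)))"
    using infinite_range_code finite_stem finite_block
    by (intro Diff_infinite_finite) (auto simp: range_mathias_branch)
  from infinite_imp_nonempty[OF this] obtain z where z: "z \<in> range (mathias_branch s A \<xi>)" "z \<notin> t \<union> (\<Union>i\<le>M. a i)"
    by blast
  then obtain m where m: "z \<in> a m" "\<not> m \<le> M"
    using range_branch_subset[OF \<xi>[unfolded Ta]] by blast
  have "a m \<subseteq> range (mathias_branch s A \<xi>)"
    using block_subset_range_branch[OF \<xi>[unfolded Ta] m(1) z(1)] .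
  then have block: "\<exists>i>N. p = x \<xi> i" if "p \<in> a m" for p
  proof -
    have "M < p" using le_block[OF that] m(2) by simp
    moreover have "p \<in> s \<union> range (x \<xi>)"
      using \<open>a m \<subseteq> _\<close> that unfolding range_x by blast
    ultimately obtain i where i: "p = x \<xi> i" using M(2)[of p] not_le by blast
    have "x \<xi> N < x \<xi> i" using M(1) \<open>M < p\<close> i by simp
    then have "N < i"
      using strict_mono_less[OF strict_mono_x] by blast
    then show ?thesis using i by blast
  qed
  obtain p q r where pqr: "p \<in> a m" "q \<in> a m" "r \<in> a m" "p < q" "q < r" using thick by blast
  obtain i j k where ijk: "N < j" "p = x \<xi> i" "q = x \<xi> j" "r = x \<xi> k"
    using block[OF pqr(1)] block[OF pqr(2)] block[OF pqr(3)] by blast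
  have "i < j" "j < k"
    using pqr(4,5) strict_mono_less[OF strict_mono_x] unfolding ijk by blast+
  then have "p < x \<eta> j" "x \<eta> j < r"
    unfolding ijk x_def using infinite_A by (simp_all add: initial_code_less)
  moreover have "x \<eta> j \<in> t \<union> (\<Union>i. a i)"
    using range_branch_subset[of "mathias_branch s A \<eta>"] \<eta> unfolding Ta range_x by blast
  ultimately have "x \<eta> j \<in> a m" using block_convex pqr(1,3) by blast
  then obtain l where "x \<eta> j = x \<xi> l" using block by blast
  then have "initial_code \<xi> l = initial_code \<eta> j"
    using strict_mono_eq[OF strict_mono_enumerate[OF infinite_A]] by (simp add: x_def)
  then show False using N ijk(1) by blast
qed

end

section \<open>The diagonal construction\<close>

theorem theorem2p9:
  shows "\<exists>X. X \<subseteq> incr_inf_seqs \<and> X \<in> t0_ideal \<and> X \<notin> r0_ideal"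
proof -
  \<comment> \<open>Trees have type \<open>nat list set\<close>, while the families of branches and
    subtrees are indexed by \<open>nat set\<close>; this injection compares the two sizes.\<close>
  have "inj (image (to_nat :: nat list \<Rightarrow> nat))"
    by (intro injI) (simp add: inj_image_eq_iff)
  moreover have "infinite (UNIV :: nat list set set)"
    using infinite_UNIV_listI by (simp add: Finite_Set.finite_set)
  ultimately obtain I :: "nat list set \<Rightarrow> nat list set set"
    where total: "\<And>S T. S \<in> I T \<or> T \<in> I S"
      and small: "\<And>T (f :: nat set \<Rightarrow> nat list set). inj f \<Longrightarrow> \<not> range f \<subseteq> I T"
    using ex_small_initial_segments by metis
  have "\<exists>x \<in> branches T. \<forall>S \<in> I T \<inter> thick_trees. x \<notin> branches S" if T: "T \<in> mathias_trees" for T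
  proof (rule ccontr)
    assume contra: "\<not> ?thesis"
    obtain s A where T: "T = mathias_tree s A" and sA: "finite s" "infinite A"
      using T by (auto simp: mathias_trees_def)
    have "\<exists>S \<in> I T \<inter> thick_trees. mathias_branch s A \<xi> \<in> branches S" for \<xi>
      using contra mathias_branch_in_branches[OF sA] T by blast
    then obtain f where f: "\<And>\<xi>. f \<xi> \<in> I T \<inter> thick_trees"
      "\<And>\<xi>. mathias_branch s A \<xi> \<in> branches (f \<xi>)" by metis
    have "inj f"
      using f thick_tree_at_most_one_branch[OF sA] by (intro injI) (metis IntE)
    then show False using small f(1) by blast
  qed
  then obtain x where x: "\<And>T. T \<in> mathias_trees \<Longrightarrow> x T \<in> branches T"
    and avoid: "\<And>S T. T \<in> mathias_trees \<Longrightarrow> S \<in> I T \<Longrightarrow> S \<in> thick_trees \<Longrightarrow> x T \<notin> branches S"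
    by (metis IntI)
  define X where "X = x ` mathias_trees"
  have X: "X \<subseteq> incr_inf_seqs" using x by (auto simp: X_def branches_def)
  have "\<exists>T'\<in>matet_trees. T' \<subseteq> T \<and> branches T' \<inter> X = {}" if T: "T \<in> matet_trees" for T
  proof (rule ccontr)
    assume contra: "\<not> ?thesis"
    obtain s a where "block_sequence s a" and Ta: "T = matet_tree s a"
      using T by (rule matet_treesE)
    \<comment> \<open>The points \<open>x R\<close> avoid only thick trees, so the blocks are
      thickened before they are thinned out.\<close>
    then obtain b where thick: "thick_block_sequence s b" and sub: "matet_tree s b \<subseteq> T"
      using block_sequence.ex_thick by metis
    interpret b: thick_block_sequence s b by (fact thick)
    define S where "S \<xi> = matet_tree s (b \<circ> initial_code \<xi>)" for \<xi>
    have S: "S \<xi> \<subseteq> matet_tree s b" "S \<xi> \<in> matet_trees" for \<xi>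
      using b.subsequence[OF strict_mono_initial_code] block_sequence.matet_tree_in_matet_trees
      by (auto simp: S_def)
    then have "\<exists>R\<in>mathias_trees. x R \<in> branches (S \<xi>)" for \<xi>
      using contra sub by (fastforce simp: X_def)
    then obtain f where f: "\<And>\<xi>. f \<xi> \<in> mathias_trees" "\<And>\<xi>. x (f \<xi>) \<in> branches (S \<xi>)" by metis
    have "inj f"
      using f(2) b.almost_disjoint_subsequences unfolding S_def by (intro injI) metis
    \<comment> \<open>If the thick tree preceded \<open>f \<xi>\<close>, then
      \<open>x (f \<xi>)\<close> would have been chosen off it. So only Mathias trees in its small
      segment can put points on its subtrees.\<close>
    moreover have "f \<xi> \<in> I (matet_tree s b)" for \<xi>
    proof (rule ccontr)
      assume "f \<xi> \<notin> I (matet_tree s b)"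
      then have "matet_tree s b \<in> I (f \<xi>)" using total by blast
      moreover have "matet_tree s b \<in> thick_trees" using thick by (auto simp: thick_trees_def)
      ultimately have "x (f \<xi>) \<notin> branches (matet_tree s b)" using avoid f(1) by blast
      then show False using f(2) S(1) by (auto simp: branches_def)
    qed
    ultimately show False using small by blast
  qed
  then have "X \<in> t0_ideal" using X by (simp add: t0_ideal_def assoc_ideal_def)
  moreover have "X \<notin> r0_ideal"
  proof
    assume "X \<in> r0_ideal"
    \<comment> \<open>It is enough to test one Mathias tree: each Mathias subtree \<open>T\<close>
      of it contains its own point \<open>x T\<close> of \<open>X\<close>.\<close>
    moreover have "mathias_tree {} UNIV \<in> mathias_trees"
      by (auto simp: mathias_trees_def set_before_def)
    ultimately obtain T where "T \<in> mathias_trees" "branches T \<inter> X = {}"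
      by (auto simp: r0_ideal_def assoc_ideal_def)
    then show False using x by (auto simp: X_def)
  qed
  ultimately show ?thesis using X by blast
qed

end
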